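(* Let $n$ be a non-negative integer, let $\mathcal{X}=\{X_\alpha\mid\alpha\in I\}$ be a metric family, where $I$ is a countable indexing set, and let $\mathfrak{C}$ be a collection of metric families that is closed under coarse embeddings. Then $\mathcal{X}$ is $n$-decomposable over $\mathfrak{C}$ if and only if the following Condition (C) holds. (C) For every $\varepsilon>0$ there exist a uniform simplicial complex $K_\alpha$ and an $\varepsilon$-Lipschitz map $\varphi_\alpha:X_\alpha\to K_\alpha$, for each $\alpha\in I$, such that: (i) $\dim(K_\alpha)\le n$ for every $\alpha\in I$; and (ii) $\bigcup_{\alpha\in I}\big\{\varphi_\alpha^{-1}(\operatorname{star}(v))\;\big|\;v\in K_\alpha^{(0)}\big\}$ is a metric family in $\mathfrak{C}$.
   Context: A metric family is a (countable) collection of metric spaces. Subsets of a metric space carry the subspace metric. Decomposition: Let $r>0$ and let $n$ be a non-negative integer. A metric family $\mathcal{X}$ is $(r,n)$-decomposable over a metric family $\mathcal{Y}$ if every $X\in\mathcal{X}$ can be written as $X=X_0\cup X_1\cup\cdots\cup X_n$ such that each $X_i$ is an $r$-disjoint union $X_i=\bigsqcup_j X_{ij}$ with each $X_{ij}$ in $\mathcal{Y}$. Here $r$-disjoint means $d(U,V)>r$ for any two distinct members $U\neq V$ of the union. If $\mathfrak{C}$ is a collection of metric families, $\mathcal{X}$ is $n$-decomposable over $\mathfrak{C}$ if for every $r>0$ it is $(r,n)$-decomposable over some metric family $\mathcal{Y}$ in $\mathfrak{C}$. Coarse embeddings: A map of metric families $F:\mathcal{X}\to\mathcal{Y}$ is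 a collection of functions $f:X\to Y$, with $X\in\mathcal{X}$ and $Y\in\mathcal{Y}$, such that every $X\in\mathcal{X}$ is the domain of at least one $f$ in $F$. It is a coarse embedding if there exist non-decreasing functions $\delta,\rho:[0,\infty)\to[0,\infty)$ with $\lim_{t\to\infty}\delta(t)=\infty=\lim_{t\to\infty}\rho(t)$ such that for every $f:X\to Y$ in $F$ and all $x,y\in X$, $\delta(d_X(x,y))\le d_Y(f(x),f(y))\le\rho(d_X(x,y))$. A collection $\mathfrak{C}$ of metric families is closed under coarse embeddings if every metric family that coarsely embeds into a metric family in $\mathfrak{C}$ is also in $\mathfrak{C}$. Uniform simplicial complexes: a uniform simplicial complex $K$ is a simplicial complex equipped with the $\ell^1$-metric: each $x\in K$ is uniquely $x=\sum_{v\in K^{(0)}}x_v\cdot v$, where $K^{(0)}$ is the vertex set, $x_v\in[0,1]$, $x_v=0$ for all but finitely many $v$, and $\sum_v x_v=1$; the metric is $d^1(x,y)=\sum_{v\in K^{(0)}}|x_v-y_v|$. The open star of a vertex $v$ is $\operatorname{star}(v)=\{x\in K\mid x_v\ne0\}$. For an integer $m$, $\dim(K)\le m$ means that for every $x\in K$ the set $\{v\in K^{(0)}\mid x_v\neq0\}$ has at most $m+1$ elements. A map $\varphi:X\to K$ is $\varepsilon$-Lipschitz if $d^1(\varphi(x),\varphi(y))\le\varepsilon\,d(x,y)$ for all $x,y\in X$. *)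

theory Defs
  imports "HOL-Analysis.Analysis" "HOL-Library.Infinite_Typeclass"
begin

section \<open>Metric families\<close>

text \<open>
  All members of a metric family live on one carrier type, so that a collection of metric families
  has type \<open>'a metric set set\<close>.
\<close>

definition metric_family :: "'a metric set \<Rightarrow> bool" where
  "metric_family \<X> \<longleftrightarrow> countable \<X>"

text \<open>
  The value \<open>mdist M x y\<close> is not determined by the metric space \<open>M\<close> when \<open>x\<close> or \<open>y\<close> lies outside
  \<open>mspace M\<close>, and \<open>submetric M S\<close> inherits such values from \<open>M\<close>. Equality of metric spaces
  therefore has to be compared on the carriers only.
\<close>

definition same_metric_space :: "'a metric \<Rightarrow> 'a metric \<Rightarrow> bool" where
  "same_metric_space M N \<longleftrightarrow>
     mspace M = mspace N \<and> (\<forall>x\<in>mspace M. \<forall>y\<in>mspace M. mdist M x y = mdist N x y)"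


section \<open>Decomposability\<close>

text \<open>The infimum is taken in the extended reals, so the distance to the empty set is \<open>\<infinity>\<close>.\<close>

definition mset_dist :: "'a metric \<Rightarrow> 'a set \<Rightarrow> 'a set \<Rightarrow> ereal" where
  "mset_dist M U V = (INF u\<in>U. INF v\<in>V. ereal (mdist M u v))"

definition r_disjoint :: "'a metric \<Rightarrow> real \<Rightarrow> 'a set set \<Rightarrow> bool" where
  "r_disjoint M r P \<longleftrightarrow> (\<forall>U\<in>P. \<forall>V\<in>P. U \<noteq> V \<longrightarrow> mset_dist M U V > ereal r)"

text \<open>\<open>P i\<close> is the collection of the pieces \<open>X\<^sub>i\<^sub>j\<close>, so that \<open>X\<^sub>i = \<Union>(P i)\<close>.\<close>

definition rn_decomposable :: "real \<Rightarrow> nat \<Rightarrow> 'a metric set \<Rightarrow> 'a metric set \<Rightarrow> bool" where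
  "rn_decomposable r n \<X> \<Y> \<longleftrightarrow>
     (\<forall>X\<in>\<X>. \<exists>P :: nat \<Rightarrow> 'a set set.
        mspace X = (\<Union>i\<le>n. \<Union>(P i)) \<and>
        (\<forall>i\<le>n. r_disjoint X r (P i) \<and>
               (\<forall>S\<in>P i. \<exists>Y\<in>\<Y>. same_metric_space Y (submetric X S))))"

definition decomposable :: "nat \<Rightarrow> 'a metric set \<Rightarrow> 'a metric set set \<Rightarrow> bool" where
  "decomposable n \<X> \<CC> \<longleftrightarrow> (\<forall>r>0. \<exists>\<Y>\<in>\<CC>. rn_decomposable r n \<X> \<Y>)"


section \<open>Coarse embeddings\<close>

text \<open>A function \<open>f : X \<rightarrow> Y\<close> belonging to a map of metric families is recorded as \<open>(X, f, Y)\<close>.\<close>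

definition family_map ::
  "('a metric \<times> ('a \<Rightarrow> 'b) \<times> 'b metric) set \<Rightarrow> 'a metric set \<Rightarrow> 'b metric set \<Rightarrow> bool" where
  "family_map F \<X> \<Y> \<longleftrightarrow>
     (\<forall>(X, f, Y)\<in>F. X \<in> \<X> \<and> Y \<in> \<Y> \<and> f \<in> mspace X \<rightarrow> mspace Y) \<and>
     (\<forall>X\<in>\<X>. \<exists>f Y. (X, f, Y) \<in> F)"

definition control_function :: "(real \<Rightarrow> real) \<Rightarrow> bool" where
  "control_function \<rho> \<longleftrightarrow>
     \<rho> \<in> {0..} \<rightarrow> {0..} \<and> mono_on {0..} \<rho> \<and> filterlim \<rho> at_top at_top"

definition coarse_embedding ::
  "('a metric \<times> ('a \<Rightarrow> 'b) \<times> 'b metric) set \<Rightarrow> 'a metric set \<Rightarrow> 'b metric set \<Rightarrow> bool" where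
  "coarse_embedding F \<X> \<Y> \<longleftrightarrow>
     family_map F \<X> \<Y> \<and>
     (\<exists>\<delta> \<rho>. control_function \<delta> \<and> control_function \<rho> \<and>
        (\<forall>(X, f, Y)\<in>F. \<forall>x\<in>mspace X. \<forall>y\<in>mspace X.
           \<delta> (mdist X x y) \<le> mdist Y (f x) (f y) \<and> mdist Y (f x) (f y) \<le> \<rho> (mdist X x y)))"

definition closed_under_coarse_embeddings :: "'a metric set set \<Rightarrow> bool" where
  "closed_under_coarse_embeddings \<CC> \<longleftrightarrow>
     (\<forall>\<X> \<Y> F. metric_family \<X> \<and> \<Y> \<in> \<CC> \<and> coarse_embedding F \<X> \<Y> \<longrightarrow> \<X> \<in> \<CC>)"


section \<open>Uniform simplicial complexes\<close>

text \<open>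
  An abstract simplicial complex is given by its set of (nonempty) simplices; the empty complex is
  allowed. Points of its realization are families of barycentric coordinates. Existence of a complex
  can only be asserted for a fixed type of vertices; an arbitrary type of class \<open>infinite\<close> is used
  there, which makes room for any countable set of vertices.
\<close>

definition abstract_complex :: "'v set set \<Rightarrow> bool" where
  "abstract_complex K \<longleftrightarrow>
     (\<forall>\<sigma>\<in>K. finite \<sigma> \<and> \<sigma> \<noteq> {} \<and> (\<forall>\<tau>. \<tau> \<subseteq> \<sigma> \<and> \<tau> \<noteq> {} \<longrightarrow> \<tau> \<in> K))"

definition vertices :: "'v set set \<Rightarrow> 'v set" where
  "vertices K = \<Union>K"

definition realization :: "'v set set \<Rightarrow> ('v \<Rightarrow> real) set" where
  "realization K =
     {x. {v. x v \<noteq> 0} \<in> K \<and> finite {v. x v \<noteq> 0} \<and> (\<forall>v. 0 \<le> x v \<and> x v \<le> 1) \<and>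
         (\<Sum>v | x v \<noteq> 0. x v) = 1}"

text \<open>Only finitely many vertices contribute to the sum over all vertices.\<close>

definition l1_dist :: "('v \<Rightarrow> real) \<Rightarrow> ('v \<Rightarrow> real) \<Rightarrow> real" where
  "l1_dist x y = (\<Sum>v | x v \<noteq> 0 \<or> y v \<noteq> 0. \<bar>x v - y v\<bar>)"

definition uniform_complex :: "'v set set \<Rightarrow> ('v \<Rightarrow> real) metric" where
  "uniform_complex K = metric (realization K, l1_dist)"

definition open_star :: "'v set set \<Rightarrow> 'v \<Rightarrow> ('v \<Rightarrow> real) set" where
  "open_star K v = {x \<in> realization K. x v \<noteq> 0}"

definition complex_dim_le :: "'v set set \<Rightarrow> nat \<Rightarrow> bool" where
  "complex_dim_le K m \<longleftrightarrow> (\<forall>x\<in>realization K. card {v \<in> vertices K. x v \<noteq> 0} \<le> m + 1)"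

lemma l1_dist_superset:
  assumes "finite A" "{v. x v \<noteq> 0} \<subseteq> A" "{v. y v \<noteq> 0} \<subseteq> A"
  shows "l1_dist x y = (\<Sum>v\<in>A. \<bar>x v - y v\<bar>)"
  unfolding l1_dist_def using assms by (intro sum.mono_neutral_left) auto

lemma Metric_space_realization: "Metric_space (realization (K :: 'a set set)) l1_dist"
proof
  fix x y :: "'a \<Rightarrow> real"
  show "0 \<le> l1_dist x y"
    unfolding l1_dist_def by (rule sum_nonneg) (rule abs_ge_zero)
  show "l1_dist x y = l1_dist y x"
    unfolding l1_dist_def by (rule sum.cong) (auto simp: abs_minus_commute)
next
  fix x y :: "'a \<Rightarrow> real"
  assume "x \<in> realization K" "y \<in> realization K"
  then have fin: "finite ({v. x v \<noteq> 0} \<union> {v. y v \<noteq> 0})" (is "finite ?A")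
    by (simp add: realization_def)
  have "l1_dist x y = (\<Sum>v\<in>?A. \<bar>x v - y v\<bar>)"
    by (rule l1_dist_superset[OF fin]) (rule Un_upper1, rule Un_upper2)
  also have "\<dots> = 0 \<longleftrightarrow> (\<forall>v\<in>?A. \<bar>x v - y v\<bar> = 0)"
    by (rule sum_nonneg_eq_0_iff[OF fin]) (rule abs_ge_zero)
  also have "\<dots> \<longleftrightarrow> (\<forall>v. x v = y v)"
    by (simp only: Un_iff mem_Collect_eq Ball_def abs_eq_0_iff right_minus_eq) metis
  finally show "l1_dist x y = 0 \<longleftrightarrow> x = y"
    by (simp only: fun_eq_iff)
next
  fix x y z :: "'a \<Rightarrow> real"
  assume "x \<in> realization K" "y \<in> realization K" "z \<in> realization K"
  then have fin: "finite ({v. x v \<noteq> 0} \<union> {v. y v \<noteq> 0} \<union> {v. z v \<noteq> 0})" (is "finite ?B")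
    by (simp add: realization_def)
  have eq: "l1_dist x z = (\<Sum>v\<in>?B. \<bar>x v - z v\<bar>)"
    "l1_dist x y = (\<Sum>v\<in>?B. \<bar>x v - y v\<bar>)" "l1_dist y z = (\<Sum>v\<in>?B. \<bar>y v - z v\<bar>)"
    by (rule l1_dist_superset[OF fin]; simp only: Un_upper1 Un_upper2 Un_assoc le_supI1 le_supI2)+
  have "(\<Sum>v\<in>?B. \<bar>x v - z v\<bar>) \<le> (\<Sum>v\<in>?B. \<bar>x v - y v\<bar> + \<bar>y v - z v\<bar>)"
    by (rule sum_mono) linarith
  then show "l1_dist x z \<le> l1_dist x y + l1_dist y z"
    by (simp only: eq sum.distrib)
qed

lemma mspace_uniform_complex [simp]: "mspace (uniform_complex K) = realization K"
  and mdist_uniform_complex [simp]: "mdist (uniform_complex K) = l1_dist"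
  by (simp_all add: uniform_complex_def Metric_space.mspace_metric Metric_space.mdist_metric
      Metric_space_realization)

definition Lipschitz_map :: "real \<Rightarrow> 'a metric \<Rightarrow> 'b metric \<Rightarrow> ('a \<Rightarrow> 'b) \<Rightarrow> bool" where
  "Lipschitz_map \<epsilon> M N \<phi> \<longleftrightarrow>
     \<phi> \<in> mspace M \<rightarrow> mspace N \<and>
     (\<forall>x\<in>mspace M. \<forall>y\<in>mspace M. mdist N (\<phi> x) (\<phi> y) \<le> \<epsilon> * mdist M x y)"

end

theory Submission
  imports Defs
begin

text \<open>
  A decomposition into \<open>n + 1\<close> families of far apart pieces and a contracting map to an
  \<open>n\<close>-dimensional complex carry the same information, up to bounded changes of the pieces, which a
  collection closed under coarse embeddings does not see.

  Suppose that maps to complexes are given. A point of an \<open>n\<close>-dimensional complex has at most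
  \<open>n + 1\<close> nonzero barycentric coordinates, of sum \<open>1\<close>. Hence, with \<open>c = 1 / (n + 1)\<^sup>2\<close>, there is a
  nonempty set \<open>\<sigma>\<close> of at most \<open>n + 1\<close> vertices such that every coordinate in \<open>\<sigma>\<close> exceeds every
  coordinate outside \<open>\<sigma>\<close> by at least \<open>c\<close> (\<open>exists_gap\<close>, \<open>gap_cells_cover\<close>). The sets
  of points that have this gap at \<open>\<sigma>\<close>, with \<open>\<sigma>\<close> of fixed cardinality \<open>i + 1\<close>, are \<open>2 c\<close> apart
  (\<open>gap_cells_separated\<close>): two such sets of vertices each contain a vertex which the other lacks,
  and these two coordinates compare in opposite ways. Their preimages under a \<open>c / r\<close>-Lipschitz map
  are therefore at distance at least \<open>2 r\<close>. They form the \<open>i\<close>-th layer of the decomposition, and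
  each lies in the preimage of the star of a vertex, so that the inclusions give a coarse embedding.

  Conversely, the pieces of a layer of a \<open>2 s\<close>-disjoint decomposition have disjoint
  \<open>s\<close>-thickenings, so a point lies in at most \<open>n + 1\<close> thickenings, one for each layer. The
  functions that decrease from \<open>s\<close> on a piece to \<open>0\<close> at distance \<open>s\<close> from it become,
  after normalization, barycentric coordinates on a complex whose vertices are the pieces
  (\<open>canonical_map\<close>). Their sum is at least \<open>s\<close>, which makes the Lipschitz constant a multiple of
  \<open>(n + 1) / s\<close>. The preimage of a star is a thickening, and moving each of its points to a nearby
  point of the piece distorts distances by at most \<open>2 s\<close> (\<open>thickening_nearby_point_map\<close>).
\<close>

section \<open>Closure under almost isometric maps\<close>

text \<open>
  All coarse embeddings needed here distort distances by an additive constant only: inclusions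
  (\<open>c = 0\<close>) and nearest point maps. The control functions are then \<open>max 0 (t - c)\<close> and \<open>t + c\<close>.
\<close>

lemma closed_under_almost_isometries:
  assumes closed: "closed_under_coarse_embeddings \<CC>" and Y: "\<Y> \<in> \<CC>" and "countable \<Z>" and "0 \<le> c"
    and ex: "\<And>Z. Z \<in> \<Z> \<Longrightarrow> \<exists>Y\<in>\<Y>. \<exists>f \<in> mspace Z \<rightarrow> mspace Y.
        \<forall>x\<in>mspace Z. \<forall>y\<in>mspace Z. \<bar>mdist Y (f x) (f y) - mdist Z x y\<bar> \<le> c"
  shows "\<Z> \<in> \<CC>"
proof -
  define F where "F = {(Z, f, Y). Z \<in> \<Z> \<and> Y \<in> \<Y> \<and> f \<in> mspace Z \<rightarrow> mspace Y \<and>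
      (\<forall>x\<in>mspace Z. \<forall>y\<in>mspace Z. \<bar>mdist Y (f x) (f y) - mdist Z x y\<bar> \<le> c)}"
  have "family_map F \<Z> \<Y>"
    unfolding family_map_def F_def using ex by (auto; blast)
  moreover have "control_function (\<lambda>t. max 0 (t - c))" "control_function (\<lambda>t. t + c)"
  proof -
    have "filterlim (\<lambda>t. t - c) at_top at_top" "filterlim (\<lambda>t. t + c) at_top at_top"
      using filterlim_tendsto_add_at_top[OF tendsto_const filterlim_ident, of "- c"]
        filterlim_tendsto_add_at_top[OF tendsto_const filterlim_ident, of "c"]
      by (simp_all add: add.commute)
    moreover from this(1) have "filterlim (\<lambda>t. max 0 (t - c)) at_top at_top"
      by (rule filterlim_at_top_mono) simp
    ultimately show "control_function (\<lambda>t. max 0 (t - c))" "control_function (\<lambda>t. t + c)"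
      using \<open>0 \<le> c\<close> by (auto simp: control_function_def mono_on_def)
  qed
  moreover have "max 0 (mdist Z x y - c) \<le> mdist Y (f x) (f y) \<and>
      mdist Y (f x) (f y) \<le> mdist Z x y + c"
    if "(Z, f, Y) \<in> F" "x \<in> mspace Z" "y \<in> mspace Z" for Z f Y x y
  proof -
    have "\<bar>mdist Y (f x) (f y) - mdist Z x y\<bar> \<le> c"
      using that by (auto simp: F_def)
    then show ?thesis by (auto simp: abs_le_iff)
  qed
  ultimately have "coarse_embedding F \<Z> \<Y>"
    unfolding coarse_embedding_def by blast
  then show ?thesis
    using closed Y \<open>countable \<Z>\<close>
    unfolding closed_under_coarse_embeddings_def metric_family_def by blast
qed

section \<open>Gaps between barycentric coordinates\<close>

text \<open>
  Sorted downwards, the values start at \<open>card S * c\<close> or more and would end above \<open>0\<close> if each of the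
  \<open>card S\<close> steps down, the last one being the step from the minimum to \<open>0\<close>, were
  smaller than \<open>c\<close>. The induction removes the minimum and subtracts it from the other values, unless
  the minimum itself is at least \<open>c\<close>.
\<close>

lemma exists_gap:
  fixes f :: "'v \<Rightarrow> real"
  assumes "finite S" "\<And>v. v \<in> S \<Longrightarrow> f v \<ge> 0" "u \<in> S" "f u \<ge> real (card S) * c" "c > 0"
  shows "\<exists>\<sigma>. \<sigma> \<subseteq> S \<and> \<sigma> \<noteq> {} \<and> (\<forall>v\<in>\<sigma>. f v \<ge> c \<and> (\<forall>w\<in>S - \<sigma>. f v \<ge> f w + c))"
  using assms
proof (induction "card S" arbitrary: S f)
  case 0
  then show ?case by auto
next
  case (Suc k)
  define w where "w = arg_min_on f S"
  have w: "w \<in> S" "\<And>v. v \<in> S \<Longrightarrow> f w \<le> f v"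
    using Suc.prems arg_min_if_finite[of S f] arg_min_least[of S _ f] by (auto simp: w_def)
  show ?case
  proof (cases "f w \<ge> c")
    case True
    then show ?thesis
      using w Suc.prems by (intro exI[of _ S]) force
  next
    case False
    \<comment> \<open>A gap at \<open>\<sigma>\<close> for the shifted values is also a gap towards \<open>w\<close>, as \<open>?g v \<ge> c\<close> says.\<close>
    let ?S = "S - {w}" and ?g = "\<lambda>v. f v - f w"
    have k: "k = card ?S"
      using Suc.hyps w Suc.prems(1) by simp
    have fu: "f u \<ge> real k * c + c"
      using Suc.prems(4) Suc.hyps(2)[symmetric] by (simp add: algebra_simps)
    then have "u \<noteq> w"
      using False \<open>c > 0\<close> by (smt (verit) mult_nonneg_nonneg of_nat_0_le_iff)
    then have "\<exists>\<sigma>. \<sigma> \<subseteq> ?S \<and> \<sigma> \<noteq> {} \<and> (\<forall>v\<in>\<sigma>. ?g v \<ge> c \<and> (\<forall>w\<in>?S - \<sigma>. ?g v \<ge> ?g w + c))"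
      using Suc.prems w fu False k by (intro Suc.hyps(1)) auto
    then obtain \<sigma> where \<sigma>: "\<sigma> \<subseteq> ?S" "\<sigma> \<noteq> {}"
      "\<And>v. v \<in> \<sigma> \<Longrightarrow> ?g v \<ge> c" "\<And>v w. v \<in> \<sigma> \<Longrightarrow> w \<in> ?S - \<sigma> \<Longrightarrow> ?g v \<ge> ?g w + c"
      by blast
    have "f v \<ge> c \<and> (\<forall>w'\<in>S - \<sigma>. f v \<ge> f w' + c)" if "v \<in> \<sigma>" for v
      using \<sigma>(3,4)[OF that] Suc.prems(2)[OF w(1)] by force
    then show ?thesis
      using \<sigma>(1,2) by blast
  qed
qed

definition gap_cell :: "real \<Rightarrow> 'v set \<Rightarrow> ('v \<Rightarrow> real) set" where
  "gap_cell c \<sigma> = {x. \<forall>v\<in>\<sigma>. \<forall>w. w \<notin> \<sigma> \<longrightarrow> x w + c \<le> x v}"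

lemma realization_nonneg: "x \<in> realization K \<Longrightarrow> 0 \<le> x v"
  by (simp add: realization_def)

text \<open>
  The largest coordinate is at least \<open>1 / (n + 1)\<close>, being at least the average over the support, so
  that one of the at most \<open>n + 1\<close> steps from it down to \<open>0\<close> has size at least \<open>1 / (n + 1)\<^sup>2\<close>.
\<close>

lemma gap_cells_cover:
  assumes x: "x \<in> realization K" and dim: "complex_dim_le K n"
  obtains \<sigma> where "\<sigma> \<subseteq> {v. x v \<noteq> 0}" "\<sigma> \<noteq> {}" "card \<sigma> \<le> n + 1"
    "x \<in> gap_cell (1 / (real n + 1)\<^sup>2) \<sigma>"
proof -
  let ?S = "{v. x v \<noteq> 0}" and ?c = "1 / (real n + 1)\<^sup>2"
  have S: "finite ?S" "?S \<in> K" "(\<Sum>v\<in>?S. x v) = 1"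
    using x by (auto simp: realization_def)
  have nonneg: "\<And>v. x v \<ge> 0"
    using x by (rule realization_nonneg)
  have "{v \<in> vertices K. x v \<noteq> 0} = ?S"
    using S(2) by (auto simp: vertices_def)
  then have card: "card ?S \<le> n + 1"
    using dim x by (auto simp: complex_dim_le_def)
  have "\<exists>u\<in>?S. x u \<ge> 1 / (real n + 1)"
  proof (rule ccontr)
    assume "\<not> ?thesis"
    then have less: "\<And>v. v \<in> ?S \<Longrightarrow> x v < 1 / (real n + 1)"
      by force
    have "?S \<noteq> {}"
      using S(3) by (metis sum.empty zero_neq_one)
    then have "(\<Sum>v\<in>?S. x v) < (\<Sum>v\<in>?S. 1 / (real n + 1))"
      using S(1) less by (intro sum_strict_mono) auto
    also have "\<dots> \<le> 1"
      using card by (simp add: divide_simps)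
    finally show False
      using S(3) by simp
  qed
  then obtain u where u: "u \<in> ?S" "x u \<ge> 1 / (real n + 1)"
    by blast
  have "real (card ?S) * ?c \<le> (real n + 1) * ?c"
    using card by (intro mult_right_mono) auto
  also have "\<dots> = 1 / (real n + 1)"
    by (simp add: power2_eq_square)
  also have "\<dots> \<le> x u"
    by (rule u)
  finally have "real (card ?S) * ?c \<le> x u" .
  then have "\<exists>\<sigma>. \<sigma> \<subseteq> ?S \<and> \<sigma> \<noteq> {} \<and> (\<forall>v\<in>\<sigma>. x v \<ge> ?c \<and> (\<forall>w\<in>?S - \<sigma>. x v \<ge> x w + ?c))"
    using S(1) nonneg u(1) by (intro exists_gap) auto
  then obtain \<sigma> where \<sigma>: "\<sigma> \<subseteq> ?S" "\<sigma> \<noteq> {}"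
      "\<And>v. v \<in> \<sigma> \<Longrightarrow> x v \<ge> ?c" "\<And>v w. v \<in> \<sigma> \<Longrightarrow> w \<in> ?S - \<sigma> \<Longrightarrow> x v \<ge> x w + ?c"
    by blast
  have "x \<in> gap_cell ?c \<sigma>"
    unfolding gap_cell_def
  proof (intro CollectI ballI allI impI)
    fix v w assume "v \<in> \<sigma>" "w \<notin> \<sigma>"
    then show "x w + ?c \<le> x v"
      using \<sigma>(3)[of v] \<sigma>(4)[of v w] by (cases "x w = 0") auto
  qed
  moreover have "card \<sigma> \<le> n + 1"
    using card card_mono[OF S(1) \<sigma>(1)] by simp
  ultimately show thesis
    using \<sigma> that by blast
qed

text \<open>
  For \<open>v \<in> \<sigma> - \<tau>\<close> and \<open>w \<in> \<tau> - \<sigma>\<close> the difference of the coordinates \<open>v\<close> and \<open>w\<close> is at least \<open>c\<close>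
  at \<open>x\<close> and at most \<open>- c\<close> at \<open>y\<close>. Equal cardinalities ensure that both vertices exist.
\<close>

lemma gap_cells_separated:
  assumes x: "x \<in> realization K" "x \<in> gap_cell c \<sigma>"
    and y: "y \<in> realization K" "y \<in> gap_cell c \<tau>"
    and fin: "finite \<sigma>" "finite \<tau>" and card: "card \<sigma> = card \<tau>" and neq: "\<sigma> \<noteq> \<tau>"
  shows "2 * c \<le> l1_dist x y"
proof -
  have "\<not> \<sigma> \<subseteq> \<tau>" "\<not> \<tau> \<subseteq> \<sigma>"
    using card_subset_eq[of \<tau> \<sigma>] card_subset_eq[of \<sigma> \<tau>] fin card neq by auto
  then obtain v w where v: "v \<in> \<sigma>" "v \<notin> \<tau>" and w: "w \<in> \<tau>" "w \<notin> \<sigma>"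
    by blast
  let ?A = "{v. x v \<noteq> 0} \<union> {v. y v \<noteq> 0} \<union> {v, w}"
  have "finite ?A"
    using x y by (auto simp: realization_def)
  have "x w + c \<le> x v" "y v + c \<le> y w"
    using x(2) y(2) v w by (auto simp: gap_cell_def)
  then have "2 * c \<le> \<bar>x v - y v\<bar> + \<bar>x w - y w\<bar>"
    by linarith
  also have "\<dots> = (\<Sum>u\<in>{v, w}. \<bar>x u - y u\<bar>)"
    using v w by (subst sum.insert) auto
  also have "\<dots> \<le> (\<Sum>u\<in>?A. \<bar>x u - y u\<bar>)"
    using \<open>finite ?A\<close> by (intro sum_mono2) auto
  also have "\<dots> = l1_dist x y"
    using \<open>finite ?A\<close> by (intro l1_dist_superset[symmetric]) auto
  finally show ?thesis .
qed

section \<open>From maps to decompositions\<close>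

definition star_preimage :: "'a metric \<Rightarrow> 'v set set \<Rightarrow> ('a \<Rightarrow> 'v \<Rightarrow> real) \<Rightarrow> 'v \<Rightarrow> 'a set" where
  "star_preimage M K \<phi> v = {x \<in> mspace M. \<phi> x \<in> open_star K v}"

text \<open>
  Countably many star preimages leave room for uncountably many vertices, since many vertices may
  share a preimage. A nonempty preimage, however, is shared by finitely many vertices only: all of
  them lie in the support of the image of any of its points.
\<close>

lemma countable_nonempty_star_preimages:
  assumes "countable ((\<lambda>v. submetric M (star_preimage M K \<phi> v)) ` vertices K)"
  shows "countable {v \<in> vertices K. star_preimage M K \<phi> v \<noteq> {}}" (is "countable ?W")
proof -
  let ?A = "star_preimage M K \<phi>"
  have "?A ` ?W \<subseteq> mspace ` (\<lambda>v. submetric M (?A v)) ` vertices K"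
  proof
    fix B assume "B \<in> ?A ` ?W"
    then obtain v where v: "v \<in> vertices K" "B = ?A v"
      by blast
    have "B = mspace (submetric M (?A v))"
      using v(2) by (auto simp: star_preimage_def)
    then show "B \<in> mspace ` (\<lambda>v. submetric M (?A v)) ` vertices K"
      using v(1) by blast
  qed
  then have "countable (?A ` ?W)"
    by (rule countable_subset) (intro countable_image assms)
  moreover have "countable {v \<in> ?W. ?A v = B}" if B: "B \<in> ?A ` ?W" for B
  proof -
    obtain x where x: "x \<in> B"
      using B by blast
    have x': "\<phi> x \<in> realization K"
      using x B by (auto simp: star_preimage_def open_star_def)
    have "{v \<in> ?W. ?A v = B} \<subseteq> {v. \<phi> x v \<noteq> 0}"
      using x by (auto simp: star_preimage_def open_star_def)
    moreover have "finite {v. \<phi> x v \<noteq> 0}"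
      using x' by (simp add: realization_def)
    ultimately show ?thesis
      by (rule countable_finite[OF finite_subset])
  qed
  ultimately have "countable (\<Union>B\<in>?A ` ?W. {v \<in> ?W. ?A v = B})"
    by (rule countable_UN)
  then show ?thesis
    by (rule countable_subset[rotated]) blast
qed

text \<open>
  Requiring \<open>\<sigma>\<close> to lie in the support makes the set a part of the star preimage of each vertex
  of \<open>\<sigma>\<close>, provided that \<open>\<phi>\<close> maps into the realization of \<open>K\<close>.
\<close>

definition cell_preimage :: "'a metric \<Rightarrow> ('a \<Rightarrow> 'v \<Rightarrow> real) \<Rightarrow> real \<Rightarrow> 'v set \<Rightarrow> 'a set" where
  "cell_preimage M \<phi> c \<sigma> = {x \<in> mspace M. \<sigma> \<subseteq> {v. \<phi> x v \<noteq> 0} \<and> \<phi> x \<in> gap_cell c \<sigma>}"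

text \<open>
  The layer of index \<open>i\<close>, which collects the sets \<open>\<sigma>\<close> with \<open>i + 1\<close> elements. Vertices with empty star
  preimage are excluded because there may be uncountably many of them.
\<close>

definition cells :: "'a metric \<Rightarrow> 'v set set \<Rightarrow> ('a \<Rightarrow> 'v \<Rightarrow> real) \<Rightarrow> real \<Rightarrow> nat \<Rightarrow> 'a set set" where
  "cells M K \<phi> c i = cell_preimage M \<phi> c ` {\<sigma>. finite \<sigma> \<and> card \<sigma> = i + 1 \<and>
      \<sigma> \<subseteq> {v \<in> vertices K. star_preimage M K \<phi> v \<noteq> {}}}"

lemma countable_cells:
  assumes "countable ((\<lambda>v. submetric M (star_preimage M K \<phi> v)) ` vertices K)"
  shows "countable (cells M K \<phi> c i)"
proof -
  let ?W = "{v \<in> vertices K. star_preimage M K \<phi> v \<noteq> {}}"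
  have "countable {\<sigma>. finite \<sigma> \<and> \<sigma> \<subseteq> ?W}"
    by (rule countable_Collect_finite_subset[OF countable_nonempty_star_preimages[OF assms]])
  then have "countable {\<sigma>. finite \<sigma> \<and> card \<sigma> = i + 1 \<and> \<sigma> \<subseteq> ?W}"
    by (rule countable_subset[rotated]) blast
  then show ?thesis
    unfolding cells_def by (rule countable_image)
qed

lemma cell_within_star:
  assumes "\<phi> \<in> mspace M \<rightarrow> realization K" "S \<in> cells M K \<phi> c i"
  obtains v where "v \<in> vertices K" "S \<subseteq> star_preimage M K \<phi> v"
proof -
  obtain \<sigma> where \<sigma>: "S = cell_preimage M \<phi> c \<sigma>" "card \<sigma> = i + 1" "\<sigma> \<subseteq> vertices K"
    using assms(2) by (auto simp: cells_def)
  then obtain v where v: "v \<in> \<sigma>"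
    by fastforce
  have "S \<subseteq> star_preimage M K \<phi> v"
    using assms(1) v \<sigma>(1) by (auto simp: cell_preimage_def star_preimage_def open_star_def)
  then show thesis
    using that v \<sigma>(3) by blast
qed

lemma cells_cover:
  assumes \<phi>: "\<phi> \<in> mspace M \<rightarrow> realization K" and dim: "complex_dim_le K n"
  shows "mspace M = (\<Union>i\<le>n. \<Union>(cells M K \<phi> (1 / (real n + 1)\<^sup>2) i))"
proof
  show "(\<Union>i\<le>n. \<Union>(cells M K \<phi> (1 / (real n + 1)\<^sup>2) i)) \<subseteq> mspace M"
    by (auto simp: cells_def cell_preimage_def)
  show "mspace M \<subseteq> (\<Union>i\<le>n. \<Union>(cells M K \<phi> (1 / (real n + 1)\<^sup>2) i))"
  proof
    fix x assume x: "x \<in> mspace M"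
    then have \<phi>x: "\<phi> x \<in> realization K"
      using \<phi> by blast
    obtain \<sigma> where \<sigma>: "\<sigma> \<subseteq> {v. \<phi> x v \<noteq> 0}" "\<sigma> \<noteq> {}" "card \<sigma> \<le> n + 1"
      "\<phi> x \<in> gap_cell (1 / (real n + 1)\<^sup>2) \<sigma>"
      by (rule gap_cells_cover[OF \<phi>x dim])
    have supp: "finite {v. \<phi> x v \<noteq> 0}" "{v. \<phi> x v \<noteq> 0} \<in> K"
      using \<phi>x by (auto simp: realization_def)
    then have "finite \<sigma>"
      using \<sigma>(1) finite_subset by blast
    moreover have "\<sigma> \<subseteq> {v \<in> vertices K. star_preimage M K \<phi> v \<noteq> {}}"
    proof
      fix v assume "v \<in> \<sigma>"
      then have v: "\<phi> x v \<noteq> 0"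
        using \<sigma>(1) by blast
      then have "x \<in> star_preimage M K \<phi> v"
        using x \<phi>x by (simp add: star_preimage_def open_star_def)
      moreover have "v \<in> vertices K"
        using v supp(2) by (auto simp: vertices_def)
      ultimately show "v \<in> {v \<in> vertices K. star_preimage M K \<phi> v \<noteq> {}}"
        by blast
    qed
    moreover have "card \<sigma> = card \<sigma> - 1 + 1" "card \<sigma> - 1 \<le> n"
      using \<sigma>(2,3) \<open>finite \<sigma>\<close> by (auto simp: card_gt_0_iff Suc_le_eq)
    ultimately have "cell_preimage M \<phi> (1 / (real n + 1)\<^sup>2) \<sigma>
        \<in> cells M K \<phi> (1 / (real n + 1)\<^sup>2) (card \<sigma> - 1)"
      unfolding cells_def by blast
    moreover have "x \<in> cell_preimage M \<phi> (1 / (real n + 1)\<^sup>2) \<sigma>"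
      using x \<sigma> by (simp add: cell_preimage_def)
    ultimately show "x \<in> (\<Union>i\<le>n. \<Union>(cells M K \<phi> (1 / (real n + 1)\<^sup>2) i))"
      using \<open>card \<sigma> - 1 \<le> n\<close> by blast
  qed
qed

lemma cells_r_disjoint:
  assumes Lip: "Lipschitz_map (c / r) M (uniform_complex K) \<phi>" and "c > 0" "r > 0"
  shows "r_disjoint M r (cells M K \<phi> c i)"
  unfolding r_disjoint_def
proof (intro ballI impI)
  fix U V assume "U \<in> cells M K \<phi> c i" "V \<in> cells M K \<phi> c i" "U \<noteq> V"
  then obtain \<sigma> \<tau> where \<sigma>: "U = cell_preimage M \<phi> c \<sigma>" "finite \<sigma>" "card \<sigma> = i + 1"
    and \<tau>: "V = cell_preimage M \<phi> c \<tau>" "finite \<tau>" "card \<tau> = i + 1" and "\<sigma> \<noteq> \<tau>"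
    by (auto simp: cells_def)
  have "2 * r \<le> mdist M u v" if "u \<in> U" "v \<in> V" for u v
  proof -
    have uv: "u \<in> mspace M" "v \<in> mspace M" "\<phi> u \<in> gap_cell c \<sigma>" "\<phi> v \<in> gap_cell c \<tau>"
      using that \<sigma>(1) \<tau>(1) by (auto simp: cell_preimage_def)
    then have \<phi>: "\<phi> u \<in> realization K" "\<phi> v \<in> realization K"
      and le: "l1_dist (\<phi> u) (\<phi> v) \<le> c / r * mdist M u v"
      using Lip by (auto simp: Lipschitz_map_def)
    have "2 * c \<le> l1_dist (\<phi> u) (\<phi> v)"
      using gap_cells_separated[OF \<phi>(1) uv(3) \<phi>(2) uv(4)] \<sigma> \<tau> \<open>\<sigma> \<noteq> \<tau>\<close> by simp
    then have "2 * c \<le> c / r * mdist M u v"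
      using le by linarith
    then have "c * (2 * r) \<le> c * mdist M u v"
      using \<open>r > 0\<close> by (simp add: field_simps)
    then show ?thesis
      using \<open>c > 0\<close> by simp
  qed
  then have "ereal (2 * r) \<le> mset_dist M U V"
    unfolding mset_dist_def by (intro INF_greatest) simp
  then show "ereal r < mset_dist M U V"
    using \<open>r > 0\<close> by (simp add: less_le_trans[of _ "ereal (2 * r)"])
qed

text \<open>
  With Lipschitz constant \<open>c / r\<close>, cells that are \<open>2 c\<close> apart have preimages that are \<open>2 r\<close> apart. The
  factor \<open>2\<close> leaves the strict inequality intact when passing to the infimum of the distances.
\<close>

lemma decomposable_if_maps_to_complexes:
  fixes X :: "'i \<Rightarrow> 'a metric"
  assumes "countable I" and fam: "\<forall>\<Y>\<in>\<CC>. metric_family \<Y>"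
    and closed: "closed_under_coarse_embeddings \<CC>"
    and ex: "\<And>\<epsilon>. \<epsilon> > 0 \<Longrightarrow> \<exists>(K :: 'i \<Rightarrow> 'v set set) \<phi>.
       (\<forall>\<alpha>\<in>I. Lipschitz_map \<epsilon> (X \<alpha>) (uniform_complex (K \<alpha>)) (\<phi> \<alpha>) \<and> complex_dim_le (K \<alpha>) n) \<and>
       (\<Union>\<alpha>\<in>I. (\<lambda>v. submetric (X \<alpha>) (star_preimage (X \<alpha>) (K \<alpha>) (\<phi> \<alpha>) v)) ` vertices (K \<alpha>)) \<in> \<CC>"
  shows "decomposable n (X ` I) \<CC>"
  unfolding decomposable_def
proof (intro allI impI)
  fix r :: real assume "r > 0"
  define c where "c = 1 / (real n + 1)\<^sup>2"
  have "c > 0"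
    by (simp add: c_def)
  then obtain K :: "'i \<Rightarrow> 'v set set" and \<phi> where
    Lip: "\<And>\<alpha>. \<alpha> \<in> I \<Longrightarrow> Lipschitz_map (c / r) (X \<alpha>) (uniform_complex (K \<alpha>)) (\<phi> \<alpha>)"
    and dim: "\<And>\<alpha>. \<alpha> \<in> I \<Longrightarrow> complex_dim_le (K \<alpha>) n"
    and stars: "(\<Union>\<alpha>\<in>I. (\<lambda>v. submetric (X \<alpha>) (star_preimage (X \<alpha>) (K \<alpha>) (\<phi> \<alpha>) v)) ` vertices (K \<alpha>)) \<in> \<CC>"
      (is "?\<S> \<in> \<CC>")
    using ex[of "c / r"] \<open>r > 0\<close> by auto
  let ?C = "\<lambda>\<alpha>. cells (X \<alpha>) (K \<alpha>) (\<phi> \<alpha>) c"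
  let ?\<Y> = "\<Union>\<alpha>\<in>I. \<Union>i. submetric (X \<alpha>) ` ?C \<alpha> i"
  have maps: "\<phi> \<alpha> \<in> mspace (X \<alpha>) \<rightarrow> realization (K \<alpha>)" if "\<alpha> \<in> I" for \<alpha>
    using Lip[OF that] by (simp add: Lipschitz_map_def)
  have "countable ?\<S>"
    using stars fam by (auto simp: metric_family_def)
  have "countable (?C \<alpha> i)" if "\<alpha> \<in> I" for \<alpha> i
  proof (rule countable_cells)
    show "countable ((\<lambda>v. submetric (X \<alpha>) (star_preimage (X \<alpha>) (K \<alpha>) (\<phi> \<alpha>) v)) ` vertices (K \<alpha>))"
      using that by (intro countable_subset[OF _ \<open>countable ?\<S>\<close>]) blast
  qed
  then have "countable ?\<Y>"
    using \<open>countable I\<close> by (intro countable_UN countable_image) auto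
  have "?\<Y> \<in> \<CC>"
  proof (rule closed_under_almost_isometries[OF closed stars \<open>countable ?\<Y>\<close> order_refl])
    fix Z assume "Z \<in> ?\<Y>"
    then obtain \<alpha> i S where Z: "\<alpha> \<in> I" "S \<in> ?C \<alpha> i" "Z = submetric (X \<alpha>) S"
      by blast
    obtain v where "v \<in> vertices (K \<alpha>)" "S \<subseteq> star_preimage (X \<alpha>) (K \<alpha>) (\<phi> \<alpha>) v"
      by (rule cell_within_star[OF maps[OF Z(1)] Z(2)])
    then show "\<exists>Y\<in>?\<S>. \<exists>f\<in>mspace Z \<rightarrow> mspace Y.
        \<forall>x\<in>mspace Z. \<forall>y\<in>mspace Z. \<bar>mdist Y (f x) (f y) - mdist Z x y\<bar> \<le> 0"
      using Z
      by (intro bexI[of _ "submetric (X \<alpha>) (star_preimage (X \<alpha>) (K \<alpha>) (\<phi> \<alpha>) v)"]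
          bexI[of _ "\<lambda>x. x"]) auto
  qed
  moreover have "rn_decomposable r n (X ` I) ?\<Y>"
    unfolding rn_decomposable_def
  proof
    fix M assume "M \<in> X ` I"
    then obtain \<alpha> where \<alpha>: "\<alpha> \<in> I" "M = X \<alpha>"
      by blast
    have "mspace M = (\<Union>i\<le>n. \<Union>(?C \<alpha> i))"
      using cells_cover[OF maps dim, OF \<alpha>(1) \<alpha>(1)] by (simp add: c_def \<alpha>(2))
    moreover have "r_disjoint M r (?C \<alpha> i)" for i
      using cells_r_disjoint[OF Lip[OF \<alpha>(1)] \<open>c > 0\<close> \<open>r > 0\<close>] by (simp add: \<alpha>(2))
    moreover have "\<exists>Y\<in>?\<Y>. same_metric_space Y (submetric M S)" if "S \<in> ?C \<alpha> i" for S i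
    proof
      show "same_metric_space (submetric M S) (submetric M S)"
        by (simp add: same_metric_space_def)
      show "submetric M S \<in> ?\<Y>"
        using that \<alpha> by blast
    qed
    ultimately show "\<exists>P. mspace M = (\<Union>i\<le>n. \<Union>(P i)) \<and> (\<forall>i\<le>n. r_disjoint M r (P i) \<and>
        (\<forall>S\<in>P i. \<exists>Y\<in>?\<Y>. same_metric_space Y (submetric M S)))"
      by (intro exI[of _ "?C \<alpha>"] conjI allI impI ballI)
  qed
  ultimately show "\<exists>\<Y>\<in>\<CC>. rn_decomposable r n (X ` I) \<Y>"
    by blast
qed

section \<open>Normalized bump functions\<close>

definition thickening :: "'a metric \<Rightarrow> real \<Rightarrow> 'a set \<Rightarrow> 'a set" where
  "thickening M s S = {x \<in> mspace M. \<exists>y\<in>S. mdist M x y < s}"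

definition bump :: "'a metric \<Rightarrow> real \<Rightarrow> 'a set \<Rightarrow> 'a \<Rightarrow> real" where
  "bump M s S x = max 0 (s - (INF y\<in>S. mdist M x y))"

lemma bdd_below_mdist: "bdd_below (mdist M x ` S)"
  by (rule bdd_belowI2[of _ 0]) simp

lemma bump_nonneg: "0 \<le> bump M s S x"
  by (simp add: bump_def)

lemma bump_eq_0_iff:
  assumes "S \<noteq> {}" "x \<in> mspace M"
  shows "bump M s S x = 0 \<longleftrightarrow> x \<notin> thickening M s S"
proof -
  have "bump M s S x = 0 \<longleftrightarrow> \<not> (INF y\<in>S. mdist M x y) < s"
    by (auto simp: bump_def)
  also have "\<dots> \<longleftrightarrow> x \<notin> thickening M s S"
    using assms by (subst cINF_less_iff[OF _ bdd_below_mdist]) (auto simp: thickening_def)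
  finally show ?thesis .
qed

text \<open>
  This bounds the denominator of the normalization from below by \<open>s\<close>.
\<close>

lemma bump_ge_if_member:
  assumes "x \<in> S" "S \<subseteq> mspace M"
  shows "s \<le> bump M s S x"
proof -
  have "(INF y\<in>S. mdist M x y) \<le> mdist M x x"
    using assms by (intro cINF_lower bdd_below_mdist)
  also have "mdist M x x = 0"
    using assms by auto
  finally show ?thesis
    by (simp add: bump_def)
qed

lemma bump_Lipschitz:
  assumes "S \<noteq> {}" "S \<subseteq> mspace M" and x: "x \<in> mspace M" and y: "y \<in> mspace M"
  shows "\<bar>bump M s S x - bump M s S y\<bar> \<le> mdist M x y"
proof -
  have le: "(INF z\<in>S. mdist M u z) - mdist M u w \<le> (INF z\<in>S. mdist M w z)"
    if u: "u \<in> mspace M" and w: "w \<in> mspace M" for u w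
  proof (rule cINF_greatest[OF \<open>S \<noteq> {}\<close>])
    fix z assume z: "z \<in> S"
    have "(INF z\<in>S. mdist M u z) \<le> mdist M u z"
      using z by (intro cINF_lower bdd_below_mdist)
    also have "\<dots> \<le> mdist M u w + mdist M w z"
      using u w z \<open>S \<subseteq> mspace M\<close> by (intro mdist_triangle) auto
    finally show "(INF z\<in>S. mdist M u z) - mdist M u w \<le> mdist M w z"
      by linarith
  qed
  have "\<bar>(INF z\<in>S. mdist M x z) - (INF z\<in>S. mdist M y z)\<bar> \<le> mdist M x y"
    using le[OF x y] le[OF y x] mdist_commute[of M x y] by linarith
  then show ?thesis
    unfolding bump_def by linarith
qed

text \<open>
  Changing the numerators and changing the denominators each contribute at most
  \<open>(\<Sum>v\<in>B. \<bar>a v - b v\<bar>) / sum a B\<close>, the latter because the normalized values of \<open>b\<close> sum to \<open>1\<close>.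
\<close>

lemma l1_dist_normalize:
  fixes a b :: "'v \<Rightarrow> real"
  assumes "finite B" and supp: "{v. a v \<noteq> 0} \<subseteq> B" "{v. b v \<noteq> 0} \<subseteq> B"
    and b: "\<And>v. 0 \<le> b v" and pos: "0 < sum a B" "0 < sum b B"
  shows "l1_dist (\<lambda>v. a v / sum a B) (\<lambda>v. b v / sum b B) \<le> 2 * (\<Sum>v\<in>B. \<bar>a v - b v\<bar>) / sum a B"
proof -
  let ?A = "sum a B" and ?B = "sum b B" and ?D = "\<Sum>v\<in>B. \<bar>a v - b v\<bar>"
  have term_le: "\<bar>a v / ?A - b v / ?B\<bar> \<le> \<bar>a v - b v\<bar> / ?A + b v * (\<bar>?B - ?A\<bar> / (?A * ?B))" for v
  proof -
    have "a v / ?A - b v / ?B = (a v - b v) / ?A + b v * ((?B - ?A) / (?A * ?B))"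
      using pos by (simp add: field_simps)
    also have "\<bar>\<dots>\<bar> \<le> \<bar>(a v - b v) / ?A\<bar> + \<bar>b v * ((?B - ?A) / (?A * ?B))\<bar>"
      by (rule abs_triangle_ineq)
    finally show ?thesis
      using pos b[of v] by (simp add: abs_mult)
  qed
  have "l1_dist (\<lambda>v. a v / ?A) (\<lambda>v. b v / ?B) = (\<Sum>v\<in>B. \<bar>a v / ?A - b v / ?B\<bar>)"
    using \<open>finite B\<close> supp by (intro l1_dist_superset) auto
  also have "\<dots> \<le> (\<Sum>v\<in>B. \<bar>a v - b v\<bar> / ?A + b v * (\<bar>?B - ?A\<bar> / (?A * ?B)))"
    by (intro sum_mono term_le)
  also have "\<dots> = ?D / ?A + ?B * (\<bar>?B - ?A\<bar> / (?A * ?B))"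
    by (simp only: sum.distrib sum_divide_distrib sum_distrib_right)
  also have "\<dots> = (?D + \<bar>?B - ?A\<bar>) / ?A"
    using pos by (simp add: add_divide_distrib)
  also have "\<bar>?B - ?A\<bar> \<le> ?D"
    by (subst sum_subtractf[symmetric]) (rule order_trans[OF sum_abs], simp add: abs_minus_commute)
  finally show ?thesis
    using pos by (simp add: divide_right_mono)
qed

text \<open>
  The \<open>n\<close>-skeleton of the full simplex on \<open>V\<close>. As a target of the canonical map it replaces the
  nerve of the thickened cover, which is contained in it when the multiplicity is at most \<open>n + 1\<close>.
\<close>

definition skeleton :: "'v set \<Rightarrow> nat \<Rightarrow> 'v set set" where
  "skeleton V n = {\<sigma>. finite \<sigma> \<and> \<sigma> \<noteq> {} \<and> \<sigma> \<subseteq> V \<and> card \<sigma> \<le> n + 1}"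

lemma abstract_complex_skeleton: "abstract_complex (skeleton V n)"
  unfolding abstract_complex_def skeleton_def
  by (auto intro: finite_subset dest: card_mono)

lemma vertices_skeleton: "vertices (skeleton V n) = V"
proof
  show "V \<subseteq> vertices (skeleton V n)"
  proof
    fix v assume "v \<in> V"
    then have "{v} \<in> skeleton V n"
      by (simp add: skeleton_def)
    then show "v \<in> vertices (skeleton V n)"
      by (auto simp: vertices_def)
  qed
qed (auto simp: vertices_def skeleton_def)

lemma complex_dim_le_skeleton: "complex_dim_le (skeleton V n) n"
  unfolding complex_dim_le_def
proof
  fix x assume "x \<in> realization (skeleton V n)"
  then have supp: "{v. x v \<noteq> 0} \<in> skeleton V n"
    by (simp add: realization_def)
  then have "{v \<in> vertices (skeleton V n). x v \<noteq> 0} = {v. x v \<noteq> 0}"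
    by (auto simp: vertices_def)
  then show "card {v \<in> vertices (skeleton V n). x v \<noteq> 0} \<le> n + 1"
    using supp by (simp add: skeleton_def)
qed

definition bumps :: "'a metric \<Rightarrow> real \<Rightarrow> 'v set \<Rightarrow> ('v \<Rightarrow> 'a set) \<Rightarrow> 'a \<Rightarrow> 'v \<Rightarrow> real" where
  "bumps M s V U x v = (if v \<in> V then bump M s (U v) x else 0)"

text \<open>
  The partition of unity subordinate to the thickened cover, as a map into barycentric coordinates.
  The denominator runs over the support, so that it is a finite sum even if \<open>V\<close> is infinite.
\<close>

definition canonical_map :: "'a metric \<Rightarrow> real \<Rightarrow> 'v set \<Rightarrow> ('v \<Rightarrow> 'a set) \<Rightarrow> 'a \<Rightarrow> 'v \<Rightarrow> real" where
  "canonical_map M s V U x v = bumps M s V U x v / sum (bumps M s V U x) {w. bumps M s V U x w \<noteq> 0}"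

text \<open>
  At most \<open>2 (n + 1)\<close> bump functions are nonzero at \<open>x\<close> or at \<open>y\<close>; each of them changes by at most
  \<open>mdist M x y\<close>, and normalization costs a factor \<open>2 / s\<close>. This gives the constant \<open>4 (n + 1) / s\<close>.
\<close>

lemma canonical_map:
  fixes U :: "'v \<Rightarrow> 'a set"
  assumes "s > 0" and U: "\<And>v. v \<in> V \<Longrightarrow> U v \<noteq> {}" "\<And>v. v \<in> V \<Longrightarrow> U v \<subseteq> mspace M"
    and cover: "mspace M \<subseteq> (\<Union>v\<in>V. U v)"
    and mult: "\<And>x. x \<in> mspace M \<Longrightarrow>
        finite {v \<in> V. x \<in> thickening M s (U v)} \<and> card {v \<in> V. x \<in> thickening M s (U v)} \<le> n + 1"
  shows "Lipschitz_map (4 * (real n + 1) / s) M (uniform_complex (skeleton V n)) (canonical_map M s V U)"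
    and "\<And>v. v \<in> V \<Longrightarrow> star_preimage M (skeleton V n) (canonical_map M s V U) v = thickening M s (U v)"
proof -
  let ?b = "bumps M s V U" and ?\<phi> = "canonical_map M s V U"
  define supp where "supp x = {v \<in> V. x \<in> thickening M s (U v)}" for x
  have b_nonneg: "0 \<le> ?b x v" for x v
    by (simp add: bumps_def bump_nonneg)
  have supp: "{v. ?b x v \<noteq> 0} = supp x" if "x \<in> mspace M" for x
    using U that by (auto simp: supp_def bumps_def bump_eq_0_iff)
  have fin: "finite (supp x)" "card (supp x) \<le> n + 1" if "x \<in> mspace M" for x
    using mult[OF that] by (simp_all add: supp_def)
  have sum_ge: "s \<le> sum (?b x) B" if x: "x \<in> mspace M" and B: "supp x \<subseteq> B" "finite B" for x B
  proof -
    obtain v where v: "v \<in> V" "x \<in> U v"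
      using cover x by blast
    have "s \<le> ?b x v"
      using bump_ge_if_member[OF v(2) U(2)[OF v(1)]] v(1) by (simp add: bumps_def)
    moreover from this have "v \<in> B"
      using supp[OF x] B(1) \<open>s > 0\<close> by force
    then have "?b x v \<le> sum (?b x) B"
      using B(2) b_nonneg by (intro member_le_sum)
    ultimately show ?thesis
      by linarith
  qed
  have sum_eq: "sum (?b x) {w. ?b x w \<noteq> 0} = sum (?b x) B"
    if "x \<in> mspace M" "supp x \<subseteq> B" "finite B" for x B
    using that supp by (intro sum.mono_neutral_left) auto
  have \<phi>_eq: "?\<phi> x = (\<lambda>v. ?b x v / sum (?b x) B)" if "x \<in> mspace M" "supp x \<subseteq> B" "finite B" for x B
    using sum_eq[OF that] by (simp add: canonical_map_def fun_eq_iff)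
  have supp\<phi>: "{v. ?\<phi> x v \<noteq> 0} = supp x" if x: "x \<in> mspace M" for x
    using supp[OF x] sum_ge[OF x subset_refl fin(1)[OF x]] \<open>s > 0\<close>
    by (auto simp: \<phi>_eq[OF x subset_refl fin(1)[OF x]])
  have real: "?\<phi> x \<in> realization (skeleton V n)" if x: "x \<in> mspace M" for x
  proof -
    let ?B = "supp x"
    have pos: "0 < sum (?b x) ?B"
      using sum_ge[OF x subset_refl fin(1)[OF x]] \<open>s > 0\<close> by linarith
    have sum1: "sum (?\<phi> x) ?B = 1"
      using pos by (simp add: \<phi>_eq[OF x subset_refl fin(1)[OF x]] sum_divide_distrib[symmetric])
    have nonneg: "0 \<le> ?\<phi> x v" for v
      using pos b_nonneg by (simp add: \<phi>_eq[OF x subset_refl fin(1)[OF x]])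
    have le1: "?\<phi> x v \<le> 1" for v
    proof (cases "v \<in> ?B")
      case True
      then show ?thesis
        using member_le_sum[of v ?B "?\<phi> x"] nonneg fin(1)[OF x] sum1 by simp
    next
      case False
      then have "?\<phi> x v = 0"
        using supp\<phi>[OF x] by blast
      then show ?thesis by simp
    qed
    have "?B \<noteq> {}"
      using pos by auto
    then have "?B \<in> skeleton V n"
      using fin[OF x] by (auto simp: skeleton_def supp_def)
    then show ?thesis
      unfolding realization_def using supp\<phi>[OF x] fin(1)[OF x] nonneg le1 sum1 by simp
  qed
  show "Lipschitz_map (4 * (real n + 1) / s) M (uniform_complex (skeleton V n)) ?\<phi>"
    unfolding Lipschitz_map_def mspace_uniform_complex mdist_uniform_complex
  proof (intro conjI ballI)
    show "?\<phi> \<in> mspace M \<rightarrow> realization (skeleton V n)"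
      using real by blast
    fix x y assume x: "x \<in> mspace M" and y: "y \<in> mspace M"
    let ?B = "supp x \<union> supp y"
    have B: "finite ?B"
      using fin(1) x y by blast
    have "real (card ?B) \<le> real (n + 1) + real (n + 1)"
      using card_Un_le[of "supp x" "supp y"] fin(2)[OF x] fin(2)[OF y] by linarith
    then have card: "real (card ?B) \<le> 2 * (real n + 1)"
      by simp
    have A: "s \<le> sum (?b x) ?B" "s \<le> sum (?b y) ?B"
      using sum_ge B x y by auto
    have diff: "\<bar>?b x v - ?b y v\<bar> \<le> mdist M x y" for v
      using bump_Lipschitz[OF U x y] by (simp add: bumps_def)
    have "l1_dist (?\<phi> x) (?\<phi> y)
        = l1_dist (\<lambda>v. ?b x v / sum (?b x) ?B) (\<lambda>v. ?b y v / sum (?b y) ?B)"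
      using \<phi>_eq[OF x _ B] \<phi>_eq[OF y _ B] by simp
    also have "\<dots> \<le> 2 * (\<Sum>v\<in>?B. \<bar>?b x v - ?b y v\<bar>) / sum (?b x) ?B"
      using supp[OF x] supp[OF y] A \<open>s > 0\<close> by (intro l1_dist_normalize B b_nonneg) auto
    also have "\<dots> \<le> 2 * (\<Sum>v\<in>?B. \<bar>?b x v - ?b y v\<bar>) / s"
      using A \<open>s > 0\<close> by (intro divide_left_mono) (auto intro!: sum_nonneg mult_pos_pos)
    also have "\<dots> \<le> 2 * (2 * (real n + 1) * mdist M x y) / s"
    proof -
      have "(\<Sum>v\<in>?B. \<bar>?b x v - ?b y v\<bar>) \<le> real (card ?B) * mdist M x y"
        using diff by (intro sum_bounded_above)
      also have "\<dots> \<le> 2 * (real n + 1) * mdist M x y"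
        using card by (intro mult_right_mono) auto
      finally show ?thesis
        using \<open>s > 0\<close> by (intro divide_right_mono mult_left_mono) auto
    qed
    finally show "l1_dist (?\<phi> x) (?\<phi> y) \<le> 4 * (real n + 1) / s * mdist M x y"
      by (simp add: algebra_simps)
  qed
  fix v assume "v \<in> V"
  then have "?\<phi> x v \<noteq> 0 \<longleftrightarrow> x \<in> thickening M s (U v)" if "x \<in> mspace M" for x
    using supp\<phi>[OF that] by (auto simp: supp_def)
  then show "star_preimage M (skeleton V n) ?\<phi> v = thickening M s (U v)"
    using real by (auto simp: star_preimage_def open_star_def thickening_def)
qed

section \<open>From decompositions to maps\<close>

lemma thickenings_disjoint:
  assumes "r_disjoint M (2 * s) P" "S \<in> P" "T \<in> P" "S \<subseteq> mspace M" "T \<subseteq> mspace M"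
    and x: "x \<in> thickening M s S" "x \<in> thickening M s T"
  shows "S = T"
proof (rule ccontr)
  assume "S \<noteq> T"
  then have far: "ereal (2 * s) < mset_dist M S T"
    using assms by (auto simp: r_disjoint_def)
  obtain y z where yz: "y \<in> S" "z \<in> T" "mdist M x y < s" "mdist M x z < s" and "x \<in> mspace M"
    using x by (auto simp: thickening_def)
  have "mset_dist M S T \<le> ereal (mdist M y z)"
    unfolding mset_dist_def using yz by (intro INF_lower2[of y] INF_lower2[of z]) auto
  also have "mdist M y z \<le> mdist M y x + mdist M x z"
    using yz \<open>x \<in> mspace M\<close> assms(4,5) by (intro mdist_triangle) auto
  finally have "mset_dist M S T \<le> ereal (mdist M x y + mdist M x z)"
    by (simp add: mdist_commute)
  then have "ereal (2 * s) < ereal (mdist M x y + mdist M x z)"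
    using far by (rule less_le_trans[rotated])
  then show False
    using yz by simp
qed

text \<open>
  The vertices are the pairs of a layer \<open>i \<le> n\<close> and a nonempty piece of that layer, transported into
  the given infinite type. The layer has to be recorded, because a set may occur in several layers;
  the thickenings that contain a given point then belong to distinct layers. Empty pieces are
  left out, because the infimum of the empty set of real numbers is an unspecified value.
\<close>

lemma map_to_complex_of_decomposition:
  fixes M :: "'a metric" and P :: "nat \<Rightarrow> 'a set set"
  assumes "s > 0" and cover: "mspace M = (\<Union>i\<le>n. \<Union>(P i))"
    and disj: "\<And>i. i \<le> n \<Longrightarrow> r_disjoint M (2 * s) (P i)"
    and count: "\<And>i. i \<le> n \<Longrightarrow> countable (P i)"
  shows "\<exists>(K :: 'v::infinite set set) \<phi>. abstract_complex K \<and>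
      Lipschitz_map (4 * (real n + 1) / s) M (uniform_complex K) \<phi> \<and> complex_dim_le K n \<and>
      countable (vertices K) \<and>
      (\<forall>v\<in>vertices K. \<exists>i\<le>n. \<exists>S\<in>P i. star_preimage M K \<phi> v = thickening M s S)"
proof -
  define J where "J = {(i, S). i \<le> n \<and> S \<in> P i \<and> S \<noteq> {}}"
  have "countable (Sigma {..n} P)"
    using count by (intro countable_SIGMA) auto
  then have "countable J"
    by (rule countable_subset[rotated]) (auto simp: J_def)
  obtain g :: "nat \<Rightarrow> 'v" where "inj g"
    using infinite_countable_subset[OF infinite_UNIV] by blast
  define e where "e = g \<circ> to_nat_on J"
  have "inj_on e J"
    unfolding e_def
    using \<open>countable J\<close> \<open>inj g\<close> by (intro comp_inj_on inj_on_to_nat_on) (auto intro: inj_on_subset)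
  define V where "V = e ` J"
  define label where "label = inv_into J e"
  have label: "inj_on label V" "\<And>v. v \<in> V \<Longrightarrow> label v \<in> J" "\<And>j. j \<in> J \<Longrightarrow> label (e j) = j"
    using \<open>inj_on e J\<close>
    by (auto simp: label_def V_def intro: inj_on_inv_into inv_into_into)
  define U where "U v = snd (label v)" for v
  have U: "fst (label v) \<le> n" "U v \<in> P (fst (label v))" "U v \<noteq> {}" "U v \<subseteq> mspace M"
    if "v \<in> V" for v
    using label(2)[OF that] cover by (auto simp: J_def U_def)
  have "mspace M \<subseteq> (\<Union>v\<in>V. U v)"
  proof
    fix x assume "x \<in> mspace M"
    then obtain i S where "i \<le> n" "S \<in> P i" "x \<in> S"
      using cover by blast
    then have "(i, S) \<in> J"
      by (auto simp: J_def)
    then have "e (i, S) \<in> V" "x \<in> U (e (i, S))"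
      using \<open>x \<in> S\<close> label(3) by (auto simp: V_def U_def)
    then show "x \<in> (\<Union>v\<in>V. U v)"
      by blast
  qed
  moreover have "finite {v \<in> V. x \<in> thickening M s (U v)} \<and>
      card {v \<in> V. x \<in> thickening M s (U v)} \<le> n + 1" for x
  proof -
    let ?W = "{v \<in> V. x \<in> thickening M s (U v)}"
    have inj: "inj_on (\<lambda>v. fst (label v)) ?W"
    proof (rule inj_onI)
      fix v w assume vw: "v \<in> ?W" "w \<in> ?W" and eq: "fst (label v) = fst (label w)"
      have "U v = U w"
        using vw U[of v] U[of w] disj eq
        by (intro thickenings_disjoint[where P = "P (fst (label v))" and M = M and s = s]) auto
      then have "label v = label w"
        using eq by (simp add: U_def prod_eq_iff)
      then show "v = w"
        using label(1) vw by (auto dest: inj_onD)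
    qed
    have sub: "(\<lambda>v. fst (label v)) ` ?W \<subseteq> {..n}"
      using U(1) by blast
    show ?thesis
      using inj_on_finite[OF inj sub] card_inj_on_le[OF inj sub] by simp
  qed
  ultimately have Lip: "Lipschitz_map (4 * (real n + 1) / s) M (uniform_complex (skeleton V n)) (canonical_map M s V U)"
    and star: "\<And>v. v \<in> V \<Longrightarrow> star_preimage M (skeleton V n) (canonical_map M s V U) v = thickening M s (U v)"
    using canonical_map[of s V U M n] \<open>s > 0\<close> U(3,4) by blast+
  have "countable (vertices (skeleton V n))"
    using \<open>countable J\<close> by (simp add: V_def vertices_skeleton)
  moreover have "\<forall>v\<in>vertices (skeleton V n). \<exists>i\<le>n. \<exists>S\<in>P i.
      star_preimage M (skeleton V n) (canonical_map M s V U) v = thickening M s S"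
    unfolding vertices_skeleton using U(1,2) star by blast
  ultimately show ?thesis
    by (intro exI[of _ "skeleton V n"] exI[of _ "canonical_map M s V U"] conjI Lip
        abstract_complex_skeleton complex_dim_le_skeleton)
qed

lemma thickening_nearby_point_map:
  assumes "S \<subseteq> mspace M"
  obtains p where "p \<in> thickening M s S \<rightarrow> S"
    "\<And>x y. x \<in> thickening M s S \<Longrightarrow> y \<in> thickening M s S \<Longrightarrow>
        \<bar>mdist M (p x) (p y) - mdist M x y\<bar> \<le> 2 * s"
proof -
  have "\<forall>x\<in>thickening M s S. \<exists>y. y \<in> S \<and> mdist M x y < s"
    by (auto simp: thickening_def)
  from bchoice[OF this] obtain p where
    p: "\<And>x. x \<in> thickening M s S \<Longrightarrow> p x \<in> S \<and> mdist M x (p x) < s"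
    by blast
  show thesis
  proof
    show "p \<in> thickening M s S \<rightarrow> S"
      using p by blast
    fix x y assume xy: "x \<in> thickening M s S" "y \<in> thickening M s S"
    then have m: "x \<in> mspace M" "y \<in> mspace M" "p x \<in> mspace M" "p y \<in> mspace M"
      using p assms by (auto simp: thickening_def)
    have "mdist M (p x) (p y) \<le> mdist M (p x) x + mdist M x (p y)"
      "mdist M x (p y) \<le> mdist M x y + mdist M y (p y)"
      "mdist M x y \<le> mdist M x (p x) + mdist M (p x) y"
      "mdist M (p x) y \<le> mdist M (p x) (p y) + mdist M (p y) y"
      using m by (auto intro: mdist_triangle)
    then show "\<bar>mdist M (p x) (p y) - mdist M x y\<bar> \<le> 2 * s"
      using p[OF xy(1)] p[OF xy(2)] mdist_commute[of M "p x" x] mdist_commute[of M "p y" y]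
      by linarith
  qed
qed

text \<open>
  Distinct pieces have distinct carriers, so they come from distinct members of \<open>\<Y>\<close>. This is what
  allows the pieces to be vertices in an arbitrary infinite type.
\<close>

lemma countable_pieces:
  assumes "countable \<Y>" and P: "\<And>S. S \<in> P \<Longrightarrow> S \<subseteq> mspace M"
    and ex: "\<And>S. S \<in> P \<Longrightarrow> \<exists>Y\<in>\<Y>. same_metric_space Y (submetric M S)"
  shows "countable P"
proof (rule countable_subset)
  show "P \<subseteq> mspace ` \<Y>"
  proof
    fix S assume S: "S \<in> P"
    then obtain Y where "Y \<in> \<Y>" "same_metric_space Y (submetric M S)"
      using ex by blast
    moreover from this have "mspace Y = S"
      using P[OF S] by (auto simp: same_metric_space_def)
    ultimately show "S \<in> mspace ` \<Y>"
      by blast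
  qed
qed (use assms(1) in simp)

lemma maps_to_complexes_if_decomposable:
  fixes X :: "'i \<Rightarrow> 'a metric"
  assumes "countable I" and fam: "\<forall>\<Y>\<in>\<CC>. metric_family \<Y>"
    and closed: "closed_under_coarse_embeddings \<CC>"
    and dec: "decomposable n (X ` I) \<CC>" and "\<epsilon> > 0"
  shows "\<exists>(K :: 'i \<Rightarrow> 'v::infinite set set) \<phi>.
       (\<forall>\<alpha>\<in>I. abstract_complex (K \<alpha>) \<and>
               Lipschitz_map \<epsilon> (X \<alpha>) (uniform_complex (K \<alpha>)) (\<phi> \<alpha>)) \<and>
       (\<forall>\<alpha>\<in>I. complex_dim_le (K \<alpha>) n) \<and>
       (\<Union>\<alpha>\<in>I. (\<lambda>v. submetric (X \<alpha>) (star_preimage (X \<alpha>) (K \<alpha>) (\<phi> \<alpha>) v)) ` vertices (K \<alpha>)) \<in> \<CC>"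
proof -
  \<comment> \<open>The width for which the canonical map has Lipschitz constant \<open>\<epsilon>\<close>.\<close>
  define s where "s = 4 * (real n + 1) / \<epsilon>"
  have "s > 0" and \<epsilon>: "\<epsilon> = 4 * (real n + 1) / s"
    using \<open>\<epsilon> > 0\<close> by (auto simp: s_def field_simps)
  then obtain \<Y> where \<Y>: "\<Y> \<in> \<CC>" and rn: "rn_decomposable (2 * s) n (X ` I) \<Y>"
    using dec unfolding decomposable_def by (metis zero_less_mult_iff zero_less_numeral)
  have "countable \<Y>"
    using \<Y> fam by (auto simp: metric_family_def)
  define good where "good \<alpha> K \<phi> \<longleftrightarrow> abstract_complex K \<and>
      Lipschitz_map \<epsilon> (X \<alpha>) (uniform_complex K) \<phi> \<and> complex_dim_le K n \<and> countable (vertices K) \<and>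
      (\<forall>v\<in>vertices K. \<exists>S. S \<subseteq> mspace (X \<alpha>) \<and> star_preimage (X \<alpha>) K \<phi> v = thickening (X \<alpha>) s S \<and>
         (\<exists>Y\<in>\<Y>. same_metric_space Y (submetric (X \<alpha>) S)))"
    for \<alpha> and K :: "'v set set" and \<phi>
  have "\<exists>K \<phi>. good \<alpha> K \<phi>" if \<alpha>: "\<alpha> \<in> I" for \<alpha>
  proof -
    have "X \<alpha> \<in> X ` I"
      using \<alpha> by (rule imageI)
    then obtain P where P: "mspace (X \<alpha>) = (\<Union>i\<le>n. \<Union>(P i))"
      and pieces: "\<forall>i\<le>n. r_disjoint (X \<alpha>) (2 * s) (P i) \<and>
        (\<forall>S\<in>P i. \<exists>Y\<in>\<Y>. same_metric_space Y (submetric (X \<alpha>) S))"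
      using rn[unfolded rn_decomposable_def, rule_format] by metis
    have sub: "S \<subseteq> mspace (X \<alpha>)" if "i \<le> n" "S \<in> P i" for i S
      unfolding P using that by blast
    have disj: "r_disjoint (X \<alpha>) (2 * s) (P i)" if "i \<le> n" for i
      using pieces that by simp
    have count: "countable (P i)" if "i \<le> n" for i
      using sub pieces that by (intro countable_pieces[OF \<open>countable \<Y>\<close>, of "P i" "X \<alpha>"]) simp_all
    obtain K :: "'v set set" and \<phi> where K: "abstract_complex K"
      "Lipschitz_map \<epsilon> (X \<alpha>) (uniform_complex K) \<phi>" "complex_dim_le K n" "countable (vertices K)"
      and stars: "\<forall>v\<in>vertices K. \<exists>i\<le>n. \<exists>S\<in>P i. star_preimage (X \<alpha>) K \<phi> v = thickening (X \<alpha>) s S"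
      using map_to_complex_of_decomposition[where 'v = 'v, OF \<open>s > 0\<close> P disj count, folded \<epsilon>] by metis
    have "\<exists>S. S \<subseteq> mspace (X \<alpha>) \<and> star_preimage (X \<alpha>) K \<phi> v = thickening (X \<alpha>) s S \<and>
        (\<exists>Y\<in>\<Y>. same_metric_space Y (submetric (X \<alpha>) S))" if v: "v \<in> vertices K" for v
    proof -
      obtain i S where "i \<le> n" "S \<in> P i" "star_preimage (X \<alpha>) K \<phi> v = thickening (X \<alpha>) s S"
        using stars v by metis
      then show ?thesis
        using sub pieces by metis
    qed
    then have "good \<alpha> K \<phi>"
      unfolding good_def using K by simp
    then show ?thesis
      by (intro exI)
  qed
  then obtain K \<phi> where good: "\<And>\<alpha>. \<alpha> \<in> I \<Longrightarrow> good \<alpha> (K \<alpha>) (\<phi> \<alpha>)"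
    by metis
  then have K: "\<And>\<alpha>. \<alpha> \<in> I \<Longrightarrow> abstract_complex (K \<alpha>) \<and>
      Lipschitz_map \<epsilon> (X \<alpha>) (uniform_complex (K \<alpha>)) (\<phi> \<alpha>) \<and> complex_dim_le (K \<alpha>) n \<and>
      countable (vertices (K \<alpha>))"
    and stars: "\<And>\<alpha> v. \<alpha> \<in> I \<Longrightarrow> v \<in> vertices (K \<alpha>) \<Longrightarrow> \<exists>S. S \<subseteq> mspace (X \<alpha>) \<and>
        star_preimage (X \<alpha>) (K \<alpha>) (\<phi> \<alpha>) v = thickening (X \<alpha>) s S \<and>
        (\<exists>Y\<in>\<Y>. same_metric_space Y (submetric (X \<alpha>) S))"
    by (simp_all add: good_def)
  let ?\<S> = "\<Union>\<alpha>\<in>I. (\<lambda>v. submetric (X \<alpha>) (star_preimage (X \<alpha>) (K \<alpha>) (\<phi> \<alpha>) v)) ` vertices (K \<alpha>)"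
  have "countable ?\<S>"
    using \<open>countable I\<close> K by (intro countable_UN countable_image) auto
  have "?\<S> \<in> \<CC>"
  proof (rule closed_under_almost_isometries[OF closed \<Y> \<open>countable ?\<S>\<close>, where c = "2 * s"])
    show "0 \<le> 2 * s"
      using \<open>s > 0\<close> by simp
  next
    fix Z assume "Z \<in> ?\<S>"
    then obtain \<alpha> v where \<alpha>: "\<alpha> \<in> I" "v \<in> vertices (K \<alpha>)"
      and Z: "Z = submetric (X \<alpha>) (star_preimage (X \<alpha>) (K \<alpha>) (\<phi> \<alpha>) v)"
      by blast
    obtain S Y where "S \<subseteq> mspace (X \<alpha>)" and Y: "Y \<in> \<Y>" "same_metric_space Y (submetric (X \<alpha>) S)"
      and S: "star_preimage (X \<alpha>) (K \<alpha>) (\<phi> \<alpha>) v = thickening (X \<alpha>) s S"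
      using stars[OF \<alpha>] by blast
    have Y_eq: "mspace Y = S" "\<And>x y. x \<in> S \<Longrightarrow> y \<in> S \<Longrightarrow> mdist Y x y = mdist (X \<alpha>) x y"
      using Y(2) \<open>S \<subseteq> mspace (X \<alpha>)\<close> by (auto simp: same_metric_space_def Int_absorb2)
    have Z_eq: "mspace Z = thickening (X \<alpha>) s S" "mdist Z = mdist (X \<alpha>)"
      by (auto simp: Z S thickening_def)
    obtain p where p: "p \<in> thickening (X \<alpha>) s S \<rightarrow> S"
      "\<And>x y. x \<in> thickening (X \<alpha>) s S \<Longrightarrow> y \<in> thickening (X \<alpha>) s S \<Longrightarrow>
        \<bar>mdist (X \<alpha>) (p x) (p y) - mdist (X \<alpha>) x y\<bar> \<le> 2 * s"
      using thickening_nearby_point_map[OF \<open>S \<subseteq> mspace (X \<alpha>)\<close>] by blast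
    show "\<exists>Y\<in>\<Y>. \<exists>f\<in>mspace Z \<rightarrow> mspace Y. \<forall>x\<in>mspace Z. \<forall>y\<in>mspace Z.
        \<bar>mdist Y (f x) (f y) - mdist Z x y\<bar> \<le> 2 * s"
    proof (intro bexI ballI)
      show "Y \<in> \<Y>" "p \<in> mspace Z \<rightarrow> mspace Y"
        using Y(1) p(1) by (simp_all add: Y_eq(1) Z_eq)
      fix x y assume "x \<in> mspace Z" "y \<in> mspace Z"
      then have xy: "x \<in> thickening (X \<alpha>) s S" "y \<in> thickening (X \<alpha>) s S"
        by (simp_all add: Z_eq)
      then have "mdist Y (p x) (p y) = mdist (X \<alpha>) (p x) (p y)"
        using p(1) by (intro Y_eq(2)) auto
      then show "\<bar>mdist Y (p x) (p y) - mdist Z x y\<bar> \<le> 2 * s"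
        using p(2)[OF xy] by (simp add: Z_eq)
    qed
  qed
  then show ?thesis
    using K by (intro exI[of _ K] exI[of _ \<phi>]) blast
qed

theorem proposition3p3:
  fixes n :: nat
    and I :: "'i set"
    and X :: "'i \<Rightarrow> 'a metric"
    and \<CC> :: "'a metric set set"
  assumes "countable I"
    and "\<forall>\<Y>\<in>\<CC>. metric_family \<Y>"
    and "closed_under_coarse_embeddings \<CC>"
  shows "decomposable n (X ` I) \<CC> \<longleftrightarrow>
    (\<forall>\<epsilon>>0. \<exists>(K :: 'i \<Rightarrow> 'v::infinite set set) \<phi>.
       (\<forall>\<alpha>\<in>I. abstract_complex (K \<alpha>) \<and>
               Lipschitz_map \<epsilon> (X \<alpha>) (uniform_complex (K \<alpha>)) (\<phi> \<alpha>)) \<and>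
       (\<forall>\<alpha>\<in>I. complex_dim_le (K \<alpha>) n) \<and>
       (\<Union>\<alpha>\<in>I. {submetric (X \<alpha>) {x \<in> mspace (X \<alpha>). \<phi> \<alpha> x \<in> open_star (K \<alpha>) v} |v.
                  v \<in> vertices (K \<alpha>)}) \<in> \<CC>)"
    (is "_ \<longleftrightarrow> ?C")
proof
  assume "decomposable n (X ` I) \<CC>"
  from maps_to_complexes_if_decomposable[where 'v = 'v, OF assms this] show ?C
    unfolding star_preimage_def Setcompr_eq_image by (rule allI[OF impI])
next
  assume C: ?C
  show "decomposable n (X ` I) \<CC>"
  proof (rule decomposable_if_maps_to_complexes[where 'v = 'v, OF assms])
    fix \<epsilon> :: real assume "\<epsilon> > 0"
    from C[rule_format, OF this] obtain K :: "'i \<Rightarrow> 'v set set" and \<phi> where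
      "\<forall>\<alpha>\<in>I. abstract_complex (K \<alpha>) \<and> Lipschitz_map \<epsilon> (X \<alpha>) (uniform_complex (K \<alpha>)) (\<phi> \<alpha>)"
      "\<forall>\<alpha>\<in>I. complex_dim_le (K \<alpha>) n"
      "(\<Union>\<alpha>\<in>I. (\<lambda>v. submetric (X \<alpha>) (star_preimage (X \<alpha>) (K \<alpha>) (\<phi> \<alpha>) v)) ` vertices (K \<alpha>)) \<in> \<CC>"
      unfolding star_preimage_def Setcompr_eq_image by (elim exE conjE)
    then show "\<exists>(K :: 'i \<Rightarrow> 'v set set) \<phi>.
       (\<forall>\<alpha>\<in>I. Lipschitz_map \<epsilon> (X \<alpha>) (uniform_complex (K \<alpha>)) (\<phi> \<alpha>) \<and> complex_dim_le (K \<alpha>) n) \<and>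
       (\<Union>\<alpha>\<in>I. (\<lambda>v. submetric (X \<alpha>) (star_preimage (X \<alpha>) (K \<alpha>) (\<phi> \<alpha>) v)) ` vertices (K \<alpha>)) \<in> \<CC>"
      by (intro exI[of _ K] exI[of _ \<phi>] conjI) simp_all
  qed
qed

end
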